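(* For any formulas $A(p)$ and $B(p)$, the formula $F := A(\top) \rhd B(\Box\neg A(\top))$ is a fixed point of $A(p)\rhd B(p)$ in $\mathbf{IL}^-(\mathbf{J2}_+, \mathbf{J5})$; that is, $$\mathbf{IL}^-(\mathbf{J2}_+, \mathbf{J5}) \vdash F \leftrightarrow (A(F) \rhd B(F)).$$
   Context: Formulas are generated by $A ::= \bot \mid p \mid A \to A \mid \Box A \mid A \rhd A$, where $p$ ranges over a countably infinite set of propositional variables. The symbols $\neg,\land,\lor,\leftrightarrow,\top,\Diamond$ (with $\Diamond A := \neg\Box\neg A$) are the usual abbreviations. $\neg,\Box,\Diamond$ bind most strongly. For a propositional variable $p$ and a formula $A(p)$ (which may contain other variables), $A(B)$ denotes the result of substituting $B$ for all occurrences of $p$ in $A(p)$. The logic $\mathbf{IL}^-$ has as axioms all instances of: $\mathbf{L1}$: all tautologies in this language; $\mathbf{L2}$: $\Box(A\to B)\to(\Box A\to\Box B)$; $\mathbf{L3}$: $\Box(\Box A\to A)\to\Box A$; $\mathbf{J3}$: $((A\rhd C)\land(B\rhd C))\to((A\lor B)\rhd C)$; $\mathbf{J6}$: $\Box A\leftrightarrow((\neg A)\rhd\bot)$. Its inference rules are Modus Ponens, Necessitation (from $A$ infer $\Box A$), $\mathbf{R1}$ (from $A\to B$ infer $(C\rhd A)\to(C\rhd B)$) and $\mathbf{R2}$ (from $A\to B$ infer $(B\rhd C)\to(A\rhd C)$). $\mathbf{IL}^-(\Sigma_1,\ldots,\Sigma_n)$ is the logic obtained from $\mathbf{IL}^-$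 by adding the schemata $\Sigma_1,\ldots,\Sigma_n$ as axiom schemata (with the same rules). $\mathbf{J2}_+$ is the schema $((A\rhd(B\lor C))\land(B\rhd C))\to(A\rhd C)$ and $\mathbf{J5}$ is the schema $\Diamond A\rhd A$. $L\vdash A$ means that $A$ is a theorem of $L$. *)

theory Defs
  imports Main
begin

datatype fm =
    Bot ("\<^bold>\<bottom>")
  | Var nat
  | Imp fm fm (infixr "\<^bold>\<rightarrow>" 60)
  | Box fm ("\<^bold>\<box> _" [90] 90)
  | Rhd fm fm (infix "\<rhd>" 75)

abbreviation Neg :: "fm \<Rightarrow> fm" ("\<^bold>\<not> _" [90] 90)
  where "\<^bold>\<not> A \<equiv> A \<^bold>\<rightarrow> \<^bold>\<bottom>"

abbreviation Top :: fm ("\<^bold>\<top>")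
  where "\<^bold>\<top> \<equiv> \<^bold>\<not> \<^bold>\<bottom>"

abbreviation Disj :: "fm \<Rightarrow> fm \<Rightarrow> fm" (infixr "\<^bold>\<or>" 65)
  where "A \<^bold>\<or> B \<equiv> \<^bold>\<not> A \<^bold>\<rightarrow> B"

abbreviation Conj :: "fm \<Rightarrow> fm \<Rightarrow> fm" (infixr "\<^bold>\<and>" 70)
  where "A \<^bold>\<and> B \<equiv> \<^bold>\<not> (A \<^bold>\<rightarrow> \<^bold>\<not> B)"

abbreviation Iff :: "fm \<Rightarrow> fm \<Rightarrow> fm" (infix "\<^bold>\<leftrightarrow>" 55)
  where "A \<^bold>\<leftrightarrow> B \<equiv> (A \<^bold>\<rightarrow> B) \<^bold>\<and> (B \<^bold>\<rightarrow> A)"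

abbreviation Dia :: "fm \<Rightarrow> fm" ("\<^bold>\<diamond> _" [90] 90)
  where "\<^bold>\<diamond> A \<equiv> \<^bold>\<not> \<^bold>\<box> \<^bold>\<not> A"

text \<open>\<open>subst A p C\<close> is \<open>A(C)\<close>, where \<open>A = A(p)\<close>.\<close>

primrec subst :: "fm \<Rightarrow> nat \<Rightarrow> fm \<Rightarrow> fm" where
  "subst \<^bold>\<bottom> p C = \<^bold>\<bottom>"
| "subst (Var q) p C = (if q = p then C else Var q)"
| "subst (A \<^bold>\<rightarrow> B) p C = subst A p C \<^bold>\<rightarrow> subst B p C"
| "subst (\<^bold>\<box> A) p C = \<^bold>\<box> (subst A p C)"
| "subst (A \<rhd> B) p C = subst A p C \<rhd> subst B p C"

text \<open>Truth value under an assignment to the formulas that are atomic for propositional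
  logic: variables and formulas whose outermost symbol is \<open>\<^bold>\<box>\<close> or \<open>\<rhd>\<close>.
  The values of \<open>v\<close> at other formulas are not used.\<close>

primrec tval :: "(fm \<Rightarrow> bool) \<Rightarrow> fm \<Rightarrow> bool" where
  "tval v \<^bold>\<bottom> = False"
| "tval v (Var q) = v (Var q)"
| "tval v (A \<^bold>\<rightarrow> B) = (tval v A \<longrightarrow> tval v B)"
| "tval v (\<^bold>\<box> A) = v (\<^bold>\<box> A)"
| "tval v (A \<rhd> B) = v (A \<rhd> B)"

definition tautology :: "fm \<Rightarrow> bool" where
  "tautology A \<longleftrightarrow> (\<forall>v. tval v A)"

text \<open>\<open>ILm \<Sigma> \<turnstile> A\<close>: the formula \<open>A\<close> is a theorem of \<open>IL\<^sup>-\<close> extended by the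
  axioms in \<open>\<Sigma>\<close>. A schema is represented by the set of all its instances, and several
  schemata by the union of these sets.\<close>

inductive ILm :: "fm set \<Rightarrow> fm \<Rightarrow> bool" ("ILm _ \<turnstile> _" [100, 50] 50) for \<Sigma> :: "fm set" where
  Ax: "A \<in> \<Sigma> \<Longrightarrow> ILm \<Sigma> \<turnstile> A"
| L1: "tautology A \<Longrightarrow> ILm \<Sigma> \<turnstile> A"
| L2: "ILm \<Sigma> \<turnstile> \<^bold>\<box> (A \<^bold>\<rightarrow> B) \<^bold>\<rightarrow> (\<^bold>\<box> A \<^bold>\<rightarrow> \<^bold>\<box> B)"
| L3: "ILm \<Sigma> \<turnstile> \<^bold>\<box> (\<^bold>\<box> A \<^bold>\<rightarrow> A) \<^bold>\<rightarrow> \<^bold>\<box> A"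
| J3: "ILm \<Sigma> \<turnstile> ((A \<rhd> C) \<^bold>\<and> (B \<rhd> C)) \<^bold>\<rightarrow> ((A \<^bold>\<or> B) \<rhd> C)"
| J6: "ILm \<Sigma> \<turnstile> \<^bold>\<box> A \<^bold>\<leftrightarrow> ((\<^bold>\<not> A) \<rhd> \<^bold>\<bottom>)"
| MP: "ILm \<Sigma> \<turnstile> A \<^bold>\<rightarrow> B \<Longrightarrow> ILm \<Sigma> \<turnstile> A \<Longrightarrow> ILm \<Sigma> \<turnstile> B"
| Nec: "ILm \<Sigma> \<turnstile> A \<Longrightarrow> ILm \<Sigma> \<turnstile> \<^bold>\<box> A"
| R1: "ILm \<Sigma> \<turnstile> A \<^bold>\<rightarrow> B \<Longrightarrow> ILm \<Sigma> \<turnstile> (C \<rhd> A) \<^bold>\<rightarrow> (C \<rhd> B)"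
| R2: "ILm \<Sigma> \<turnstile> A \<^bold>\<rightarrow> B \<Longrightarrow> ILm \<Sigma> \<turnstile> (B \<rhd> C) \<^bold>\<rightarrow> (A \<rhd> C)"

definition J2plus :: "fm set" where
  "J2plus = {((A \<rhd> (B \<^bold>\<or> C)) \<^bold>\<and> (B \<rhd> C)) \<^bold>\<rightarrow> (A \<rhd> C) | A B C. True}"

definition J5 :: "fm set" where
  "J5 = {(\<^bold>\<diamond> A) \<rhd> A | A. True}"

end

(* Over J2+ and J5, Loeb's axiom makes both A |> C and C |> A insensitive to replacing A by
   A & []~A.  If []~X proves X <-> Y, then Loeb's axiom also gives []~Y -> []~X, so X & []~X and
   Y & []~Y are equivalent and X, Y are interchangeable on either side of |>.
   Write T = A(Top) and G = []~T.  On the left, []~T implies T |> Bot, hence F, so F may replace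
   Top in A(Top) under []~T.  On the right, G always implies F, while []~B(G) together
   with F = T |> B(G) implies T |> Bot, that is G; so F may replace G in B(G) under []~B(G). *)
theory Submission
  imports Defs
begin

section \<open>Propositional consequence and derived rules for []\<close>

lemma ILm_taut1:
  assumes "ILm \<Sigma> \<turnstile> P" and "\<And>v. tval v P \<Longrightarrow> tval v R"
  shows "ILm \<Sigma> \<turnstile> R"
proof -
  have "ILm \<Sigma> \<turnstile> P \<^bold>\<rightarrow> R"
    using assms(2) by (intro L1) (simp add: tautology_def)
  then show ?thesis using assms(1) by (rule MP)
qed

lemma ILm_taut2:
  assumes "ILm \<Sigma> \<turnstile> P" and "ILm \<Sigma> \<turnstile> Q"
    and "\<And>v. tval v P \<Longrightarrow> tval v Q \<Longrightarrow> tval v R"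
  shows "ILm \<Sigma> \<turnstile> R"
proof -
  have "ILm \<Sigma> \<turnstile> Q \<^bold>\<rightarrow> R"
    using assms(1) by (rule ILm_taut1) (simp add: assms(3))
  then show ?thesis using assms(2) by (rule MP)
qed

lemma ILm_taut3:
  assumes "ILm \<Sigma> \<turnstile> P" and "ILm \<Sigma> \<turnstile> Q" and "ILm \<Sigma> \<turnstile> S"
    and "\<And>v. tval v P \<Longrightarrow> tval v Q \<Longrightarrow> tval v S \<Longrightarrow> tval v R"
  shows "ILm \<Sigma> \<turnstile> R"
proof -
  have "ILm \<Sigma> \<turnstile> S \<^bold>\<rightarrow> R"
    using assms(1,2) by (rule ILm_taut2) (simp add: assms(4))
  then show ?thesis using assms(3) by (rule MP)
qed

lemma Box_mono:
  assumes "ILm \<Sigma> \<turnstile> A \<^bold>\<rightarrow> B"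
  shows "ILm \<Sigma> \<turnstile> \<^bold>\<box> A \<^bold>\<rightarrow> \<^bold>\<box> B"
  using L2 Nec[OF assms] by (rule MP)

lemma Box_mono2:
  assumes "ILm \<Sigma> \<turnstile> A \<^bold>\<rightarrow> B \<^bold>\<rightarrow> C"
  shows "ILm \<Sigma> \<turnstile> \<^bold>\<box> A \<^bold>\<rightarrow> \<^bold>\<box> B \<^bold>\<rightarrow> \<^bold>\<box> C"
  \<comment> \<open>Unfolding \<open>tval\<close> stops at boxed formulas, |>-formulas and formula
    variables; their truth values act as propositional atoms for \<open>blast\<close>.\<close>
  using Box_mono[OF assms] L2[of \<Sigma> B C] by (rule ILm_taut2) (unfold tval.simps, blast)

text \<open>The usual derivation of transitivity from Loeb's axiom, applied to \<open>?D\<close>: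
  since []\<open>?D\<close> yields []A, A implies []\<open>?D\<close> -> \<open>?D\<close>. Boxing
  this turns []A into the premise of \<open>L3\<close>.\<close>

lemma Box_4: "ILm \<Sigma> \<turnstile> \<^bold>\<box> A \<^bold>\<rightarrow> \<^bold>\<box> \<^bold>\<box> A"
proof -
  let ?D = "A \<^bold>\<and> \<^bold>\<box> A"
  have DA: "ILm \<Sigma> \<turnstile> ?D \<^bold>\<rightarrow> A"
    by (rule L1) (simp add: tautology_def)
  have DB: "ILm \<Sigma> \<turnstile> ?D \<^bold>\<rightarrow> \<^bold>\<box> A"
    by (rule L1) (simp add: tautology_def)
  have "ILm \<Sigma> \<turnstile> A \<^bold>\<rightarrow> (\<^bold>\<box> ?D \<^bold>\<rightarrow> ?D)"
    using Box_mono[OF DA] by (rule ILm_taut1) (unfold tval.simps, blast)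
  from Box_mono[OF this] have "ILm \<Sigma> \<turnstile> \<^bold>\<box> A \<^bold>\<rightarrow> \<^bold>\<box> ?D"
    using L3[of \<Sigma> ?D] by (rule ILm_taut2) (unfold tval.simps, blast)
  then show ?thesis
    using Box_mono[OF DB] by (rule ILm_taut2) (unfold tval.simps, blast)
qed

lemma Loeb_rule:
  assumes "ILm \<Sigma> \<turnstile> \<^bold>\<box> A \<^bold>\<rightarrow> A"
  shows "ILm \<Sigma> \<turnstile> A"
  using assms MP[OF L3 Nec[OF assms]] by (rule MP)

section \<open>Monotonicity of |> under boxed implications, and substitution\<close>

lemma Rhd_of_Box_Neg: "ILm \<Sigma> \<turnstile> \<^bold>\<box> \<^bold>\<not> A \<^bold>\<rightarrow> (A \<rhd> C)"
proof -
  have "ILm \<Sigma> \<turnstile> (A \<rhd> \<^bold>\<bottom>) \<^bold>\<rightarrow> (A \<rhd> C)"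
    by (intro R1 L1) (simp add: tautology_def)
  \<comment> \<open>\<open>J6\<close> at ~A speaks of ~~A |> Bot, so the double negation has to be
    removed by \<open>R2\<close>.\<close>
  moreover have "ILm \<Sigma> \<turnstile> (\<^bold>\<not> \<^bold>\<not> A \<rhd> \<^bold>\<bottom>) \<^bold>\<rightarrow> (A \<rhd> \<^bold>\<bottom>)"
    by (intro R2 L1) (simp add: tautology_def)
  ultimately show ?thesis
    using J6[of \<Sigma> "\<^bold>\<not> A"] by (rule ILm_taut3) (unfold tval.simps, blast)
qed

lemma Rhd_Bot_imp_Box_Neg: "ILm \<Sigma> \<turnstile> (A \<rhd> \<^bold>\<bottom>) \<^bold>\<rightarrow> \<^bold>\<box> \<^bold>\<not> A"
proof -
  have "ILm \<Sigma> \<turnstile> (A \<rhd> \<^bold>\<bottom>) \<^bold>\<rightarrow> (\<^bold>\<not> \<^bold>\<not> A \<rhd> \<^bold>\<bottom>)"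
    by (intro R2 L1) (simp add: tautology_def)
  then show ?thesis
    using J6[of \<Sigma> "\<^bold>\<not> A"] by (rule ILm_taut2) (unfold tval.simps, blast)
qed

text \<open>An internalised form of \<open>R2\<close>. A is covered by the exceptional part
  \<open>?D\<close>, where the implication fails, and by B. The boxed implication refutes
  \<open>?D\<close> under [], so \<open>?D\<close> |> C holds vacuously, and \<open>J3\<close> joins
  the two parts.\<close>

lemma Box_imp_Rhd_antimono:
  "ILm \<Sigma> \<turnstile> \<^bold>\<box> (A \<^bold>\<rightarrow> B) \<^bold>\<rightarrow> (B \<rhd> C) \<^bold>\<rightarrow> (A \<rhd> C)"
proof -
  let ?D = "A \<^bold>\<and> \<^bold>\<not> B"
  have "ILm \<Sigma> \<turnstile> \<^bold>\<box> (A \<^bold>\<rightarrow> B) \<^bold>\<rightarrow> \<^bold>\<box> \<^bold>\<not> ?D"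
    by (intro Box_mono L1) (simp add: tautology_def)
  then have D: "ILm \<Sigma> \<turnstile> \<^bold>\<box> (A \<^bold>\<rightarrow> B) \<^bold>\<rightarrow> (?D \<rhd> C)"
    using Rhd_of_Box_Neg[of \<Sigma> ?D C] by (rule ILm_taut2) (unfold tval.simps, blast)
  have "ILm \<Sigma> \<turnstile> ((?D \<^bold>\<or> B) \<rhd> C) \<^bold>\<rightarrow> (A \<rhd> C)"
    by (intro R2 L1) (simp add: tautology_def)
  with D J3[of \<Sigma> ?D C B] show ?thesis
    by (rule ILm_taut3) (unfold tval.simps, blast)
qed

lemma J2plus_rule:
  assumes "J2plus \<subseteq> \<Sigma>"
  shows "ILm \<Sigma> \<turnstile> ((A \<rhd> (B \<^bold>\<or> C)) \<^bold>\<and> (B \<rhd> C)) \<^bold>\<rightarrow> (A \<rhd> C)"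
  using assms by (intro Ax) (auto simp: J2plus_def)

lemma J5_rule:
  assumes "J5 \<subseteq> \<Sigma>"
  shows "ILm \<Sigma> \<turnstile> \<^bold>\<diamond> A \<rhd> A"
  using assms by (intro Ax) (auto simp: J5_def)

text \<open>The analogue for \<open>R1\<close>, with the same exceptional part \<open>?D\<close>. On
  the right of |> it is J2+ that absorbs \<open>?D\<close>, since \<open>?D\<close> |> B holds
  vacuously.\<close>

lemma Box_imp_Rhd_mono:
  assumes "J2plus \<subseteq> \<Sigma>"
  shows "ILm \<Sigma> \<turnstile> \<^bold>\<box> (A \<^bold>\<rightarrow> B) \<^bold>\<rightarrow> (C \<rhd> A) \<^bold>\<rightarrow> (C \<rhd> B)"
proof -
  let ?D = "A \<^bold>\<and> \<^bold>\<not> B"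
  have "ILm \<Sigma> \<turnstile> \<^bold>\<box> (A \<^bold>\<rightarrow> B) \<^bold>\<rightarrow> \<^bold>\<box> \<^bold>\<not> ?D"
    by (intro Box_mono L1) (simp add: tautology_def)
  then have D: "ILm \<Sigma> \<turnstile> \<^bold>\<box> (A \<^bold>\<rightarrow> B) \<^bold>\<rightarrow> (?D \<rhd> B)"
    using Rhd_of_Box_Neg[of \<Sigma> ?D B] by (rule ILm_taut2) (unfold tval.simps, blast)
  have "ILm \<Sigma> \<turnstile> (C \<rhd> A) \<^bold>\<rightarrow> (C \<rhd> (?D \<^bold>\<or> B))"
    by (intro R1 L1) (simp add: tautology_def)
  with D J2plus_rule[OF assms, of C ?D B] show ?thesis
    by (rule ILm_taut3) (unfold tval.simps, blast)
qed

lemma Rhd_trans: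
  assumes "J2plus \<subseteq> \<Sigma>"
  shows "ILm \<Sigma> \<turnstile> (A \<rhd> B) \<^bold>\<rightarrow> (B \<rhd> C) \<^bold>\<rightarrow> (A \<rhd> C)"
proof -
  have "ILm \<Sigma> \<turnstile> (A \<rhd> B) \<^bold>\<rightarrow> (A \<rhd> (B \<^bold>\<or> C))"
    by (intro R1 L1) (simp add: tautology_def)
  then show ?thesis
    using J2plus_rule[OF assms, of A B C] by (rule ILm_taut2) (unfold tval.simps, blast)
qed

text \<open>The premise has the form []K so that it survives the passage under [] and |>: by
  \<open>Box_4\<close>, an implication provable from []K is also provable from []K in boxed form.
  The induction uses this at each modal constructor.\<close>

lemma subst_cong_Box:
  assumes J2: "J2plus \<subseteq> \<Sigma>" and CD: "ILm \<Sigma> \<turnstile> \<^bold>\<box> K \<^bold>\<rightarrow> (C \<^bold>\<leftrightarrow> D)"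
  shows "ILm \<Sigma> \<turnstile> \<^bold>\<box> K \<^bold>\<rightarrow> (subst X p C \<^bold>\<leftrightarrow> subst X p D)"
proof -
  have box: "ILm \<Sigma> \<turnstile> \<^bold>\<box> K \<^bold>\<rightarrow> \<^bold>\<box> (Y \<^bold>\<rightarrow> Z)"
    if "ILm \<Sigma> \<turnstile> \<^bold>\<box> K \<^bold>\<rightarrow> (Y \<^bold>\<rightarrow> Z)" for Y Z
    using Box_4[of \<Sigma> K] Box_mono[OF that] by (rule ILm_taut2) (unfold tval.simps, blast)
  show ?thesis
  proof (induction X)
    case Bot
    show ?case by (rule L1) (simp add: tautology_def)
  next
    case (Var q)
    have "ILm \<Sigma> \<turnstile> \<^bold>\<box> K \<^bold>\<rightarrow> (Var q \<^bold>\<leftrightarrow> Var q)"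
      by (rule L1) (simp add: tautology_def)
    \<comment> \<open>For q = p the goal is \<open>CD\<close>; for any other variable it is the
      trivial equivalence.\<close>
    with CD show ?case by simp
  next
    case (Imp X Y)
    then show ?case by (rule ILm_taut2) (unfold tval.simps subst.simps, blast)
  next
    case (Box X)
    let ?x = "subst X p C" and ?y = "subst X p D"
    have xy: "ILm \<Sigma> \<turnstile> \<^bold>\<box> K \<^bold>\<rightarrow> \<^bold>\<box> (?x \<^bold>\<rightarrow> ?y)"
      and yx: "ILm \<Sigma> \<turnstile> \<^bold>\<box> K \<^bold>\<rightarrow> \<^bold>\<box> (?y \<^bold>\<rightarrow> ?x)"
      by (rule box, rule ILm_taut1[OF Box], unfold tval.simps, blast)+
    have "ILm \<Sigma> \<turnstile> \<^bold>\<box> K \<^bold>\<rightarrow> \<^bold>\<box> ?x \<^bold>\<rightarrow> \<^bold>\<box> ?y"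
      using xy L2[of \<Sigma> ?x ?y] by (rule ILm_taut2) (unfold tval.simps, blast)
    with yx L2[of \<Sigma> ?y ?x] show ?case
      by (rule ILm_taut3) (unfold tval.simps subst.simps, blast)
  next
    case (Rhd X Y)
    let ?x = "subst X p C" and ?y = "subst X p D"
    let ?u = "subst Y p C" and ?w = "subst Y p D"
    have xy: "ILm \<Sigma> \<turnstile> \<^bold>\<box> K \<^bold>\<rightarrow> \<^bold>\<box> (?x \<^bold>\<rightarrow> ?y)"
      and yx: "ILm \<Sigma> \<turnstile> \<^bold>\<box> K \<^bold>\<rightarrow> \<^bold>\<box> (?y \<^bold>\<rightarrow> ?x)"
      by (rule box, rule ILm_taut1[OF Rhd.IH(1)], unfold tval.simps, blast)+
    have uw: "ILm \<Sigma> \<turnstile> \<^bold>\<box> K \<^bold>\<rightarrow> \<^bold>\<box> (?u \<^bold>\<rightarrow> ?w)"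
      and wu: "ILm \<Sigma> \<turnstile> \<^bold>\<box> K \<^bold>\<rightarrow> \<^bold>\<box> (?w \<^bold>\<rightarrow> ?u)"
      by (rule box, rule ILm_taut1[OF Rhd.IH(2)], unfold tval.simps, blast)+
    \<comment> \<open>The two arguments are replaced one after the other, passing through
      \<open>?y\<close> |> \<open>?u\<close>.\<close>
    have "ILm \<Sigma> \<turnstile> \<^bold>\<box> K \<^bold>\<rightarrow> (?x \<rhd> ?u) \<^bold>\<rightarrow> (?y \<rhd> ?u)"
      using yx Box_imp_Rhd_antimono[of \<Sigma> ?y ?x ?u]
      by (rule ILm_taut2) (unfold tval.simps, blast)
    then have left: "ILm \<Sigma> \<turnstile> \<^bold>\<box> K \<^bold>\<rightarrow> ((?x \<rhd> ?u) \<^bold>\<leftrightarrow> (?y \<rhd> ?u))"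
      using xy Box_imp_Rhd_antimono[of \<Sigma> ?x ?y ?u]
      by (rule ILm_taut3) (unfold tval.simps, blast)
    have "ILm \<Sigma> \<turnstile> \<^bold>\<box> K \<^bold>\<rightarrow> (?y \<rhd> ?u) \<^bold>\<rightarrow> (?y \<rhd> ?w)"
      using uw Box_imp_Rhd_mono[OF J2, of ?u ?w ?y]
      by (rule ILm_taut2) (unfold tval.simps, blast)
    then have right: "ILm \<Sigma> \<turnstile> \<^bold>\<box> K \<^bold>\<rightarrow> ((?y \<rhd> ?u) \<^bold>\<leftrightarrow> (?y \<rhd> ?w))"
      using wu Box_imp_Rhd_mono[OF J2, of ?w ?u ?y]
      by (rule ILm_taut3) (unfold tval.simps, blast)
    from left right show ?case
      by (rule ILm_taut2) (unfold tval.simps subst.simps, blast)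
  qed
qed

section \<open>Loeb's axiom inside |>, and the fixed point\<close>

lemma imp_Loeb_Disj_Dia:
  "ILm \<Sigma> \<turnstile> A \<^bold>\<rightarrow> \<^bold>\<diamond> (A \<^bold>\<and> \<^bold>\<box> \<^bold>\<not> A) \<^bold>\<or> (A \<^bold>\<and> \<^bold>\<box> \<^bold>\<not> A)"
proof -
  \<comment> \<open>If the diamond disjunct fails, this implication and \<open>L3\<close> at ~A give
    []~A, so together with A the second disjunct holds.\<close>
  have "ILm \<Sigma> \<turnstile> \<^bold>\<box> \<^bold>\<not> (A \<^bold>\<and> \<^bold>\<box> \<^bold>\<not> A) \<^bold>\<rightarrow> \<^bold>\<box> (\<^bold>\<box> \<^bold>\<not> A \<^bold>\<rightarrow> \<^bold>\<not> A)"
    by (intro Box_mono L1) (auto simp: tautology_def)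
  then show ?thesis
    using L3[of \<Sigma> "\<^bold>\<not> A"] by (rule ILm_taut2) (unfold tval.simps, blast)
qed

text \<open>A implies <>\<open>?D\<close> or \<open>?D\<close>. From \<open>?D\<close> |> C, J5 and
  transitivity give <>\<open>?D\<close> |> C; \<open>J3\<close> joins both disjuncts, and
  \<open>R2\<close> returns to A.\<close>

lemma Rhd_Loeb_left:
  assumes J2: "J2plus \<subseteq> \<Sigma>" and J5: "J5 \<subseteq> \<Sigma>"
  shows "ILm \<Sigma> \<turnstile> (A \<rhd> C) \<^bold>\<leftrightarrow> ((A \<^bold>\<and> \<^bold>\<box> \<^bold>\<not> A) \<rhd> C)"
proof -
  let ?D = "A \<^bold>\<and> \<^bold>\<box> \<^bold>\<not> A"
  have "ILm \<Sigma> \<turnstile> (?D \<rhd> C) \<^bold>\<rightarrow> (\<^bold>\<diamond> ?D \<rhd> C)"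
    using Rhd_trans[OF J2, of "\<^bold>\<diamond> ?D" ?D C] J5_rule[OF J5, of ?D]
    by (rule ILm_taut2) (unfold tval.simps, blast)
  then have "ILm \<Sigma> \<turnstile> (?D \<rhd> C) \<^bold>\<rightarrow> (A \<rhd> C)"
    using J3[of \<Sigma> "\<^bold>\<diamond> ?D" C ?D] R2[OF imp_Loeb_Disj_Dia[of \<Sigma> A], of C]
    by (rule ILm_taut3) (unfold tval.simps, blast)
  moreover have "ILm \<Sigma> \<turnstile> (A \<rhd> C) \<^bold>\<rightarrow> (?D \<rhd> C)"
    by (intro R2 L1) (simp add: tautology_def)
  ultimately show ?thesis by (rule ILm_taut2) (unfold tval.simps, blast)
qed

text \<open>\<open>R1\<close> weakens A to <>\<open>?D\<close> or \<open>?D\<close>; since J5 gives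
  <>\<open>?D\<close> |> \<open>?D\<close>, J2+ removes the diamond disjunct.\<close>

lemma Rhd_Loeb_right:
  assumes J2: "J2plus \<subseteq> \<Sigma>" and J5: "J5 \<subseteq> \<Sigma>"
  shows "ILm \<Sigma> \<turnstile> (C \<rhd> A) \<^bold>\<leftrightarrow> (C \<rhd> (A \<^bold>\<and> \<^bold>\<box> \<^bold>\<not> A))"
proof -
  let ?D = "A \<^bold>\<and> \<^bold>\<box> \<^bold>\<not> A"
  have "ILm \<Sigma> \<turnstile> (C \<rhd> A) \<^bold>\<rightarrow> (C \<rhd> ?D)"
    using R1[OF imp_Loeb_Disj_Dia[of \<Sigma> A], of C]
      J2plus_rule[OF J2, of C "\<^bold>\<diamond> ?D" ?D] J5_rule[OF J5, of ?D]
    by (rule ILm_taut3) (unfold tval.simps, blast)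
  moreover have "ILm \<Sigma> \<turnstile> (C \<rhd> ?D) \<^bold>\<rightarrow> (C \<rhd> A)"
    by (intro R1 L1) (simp add: tautology_def)
  ultimately show ?thesis by (rule ILm_taut2) (unfold tval.simps, blast)
qed

lemma Loeb_equiv:
  assumes XY: "ILm \<Sigma> \<turnstile> \<^bold>\<box> \<^bold>\<not> X \<^bold>\<rightarrow> (X \<^bold>\<leftrightarrow> Y)"
  shows "ILm \<Sigma> \<turnstile> (X \<^bold>\<and> \<^bold>\<box> \<^bold>\<not> X) \<^bold>\<leftrightarrow> (Y \<^bold>\<and> \<^bold>\<box> \<^bold>\<not> Y)"
proof -
  have "ILm \<Sigma> \<turnstile> \<^bold>\<box> \<^bold>\<not> X \<^bold>\<rightarrow> \<^bold>\<not> X \<^bold>\<rightarrow> \<^bold>\<not> Y"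
    using XY by (rule ILm_taut1) (unfold tval.simps, blast)
  from Box_mono2[OF this] have 1: "ILm \<Sigma> \<turnstile> \<^bold>\<box> \<^bold>\<not> X \<^bold>\<rightarrow> \<^bold>\<box> \<^bold>\<not> Y"
    using Box_4[of \<Sigma> "\<^bold>\<not> X"] by (rule ILm_taut2) (unfold tval.simps, blast)
  \<comment> \<open>\<open>XY\<close> is available only under []~X, so the converse cannot be
    obtained by boxing as above. Instead \<open>?L\<close> is shown to follow from its own box:
    []\<open>?L\<close> turns [][]~Y into [][]~X, which is what the boxed form of \<open>XY\<close>
    asks for.\<close>
  let ?L = "\<^bold>\<box> \<^bold>\<not> Y \<^bold>\<rightarrow> \<^bold>\<box> \<^bold>\<not> X"
  have "ILm \<Sigma> \<turnstile> \<^bold>\<box> \<^bold>\<not> X \<^bold>\<rightarrow> \<^bold>\<not> Y \<^bold>\<rightarrow> \<^bold>\<not> X"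
    using XY by (rule ILm_taut1) (unfold tval.simps, blast)
  from Box_mono2[OF this]
  have "ILm \<Sigma> \<turnstile> \<^bold>\<box> ?L \<^bold>\<rightarrow> ?L"
    using L2[of \<Sigma> "\<^bold>\<box> \<^bold>\<not> Y" "\<^bold>\<box> \<^bold>\<not> X"] Box_4[of \<Sigma> "\<^bold>\<not> Y"]
    by (rule ILm_taut3) (unfold tval.simps, blast)
  then have "ILm \<Sigma> \<turnstile> ?L" by (rule Loeb_rule)
  with XY 1 show ?thesis by (rule ILm_taut3) (unfold tval.simps, blast)
qed

lemma Rhd_left_exchange:
  assumes J: "J2plus \<subseteq> \<Sigma>" "J5 \<subseteq> \<Sigma>"
    and XY: "ILm \<Sigma> \<turnstile> \<^bold>\<box> \<^bold>\<not> X \<^bold>\<rightarrow> (X \<^bold>\<leftrightarrow> Y)"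
  shows "ILm \<Sigma> \<turnstile> (X \<rhd> C) \<^bold>\<leftrightarrow> (Y \<rhd> C)"
proof -
  let ?X = "X \<^bold>\<and> \<^bold>\<box> \<^bold>\<not> X" and ?Y = "Y \<^bold>\<and> \<^bold>\<box> \<^bold>\<not> Y"
  have "ILm \<Sigma> \<turnstile> (?X \<rhd> C) \<^bold>\<rightarrow> (?Y \<rhd> C)"
    by (rule R2, rule ILm_taut1[OF Loeb_equiv[OF XY]]) (unfold tval.simps, blast)
  moreover have "ILm \<Sigma> \<turnstile> (?Y \<rhd> C) \<^bold>\<rightarrow> (?X \<rhd> C)"
    by (rule R2, rule ILm_taut1[OF Loeb_equiv[OF XY]]) (unfold tval.simps, blast)
  ultimately have "ILm \<Sigma> \<turnstile> (?X \<rhd> C) \<^bold>\<leftrightarrow> (?Y \<rhd> C)"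
    by (rule ILm_taut2) (unfold tval.simps, blast)
  with Rhd_Loeb_left[OF J, of X C] Rhd_Loeb_left[OF J, of Y C] show ?thesis
    by (rule ILm_taut3) (unfold tval.simps, blast)
qed

lemma Rhd_right_exchange:
  assumes J: "J2plus \<subseteq> \<Sigma>" "J5 \<subseteq> \<Sigma>"
    and XY: "ILm \<Sigma> \<turnstile> \<^bold>\<box> \<^bold>\<not> X \<^bold>\<rightarrow> (X \<^bold>\<leftrightarrow> Y)"
  shows "ILm \<Sigma> \<turnstile> (C \<rhd> X) \<^bold>\<leftrightarrow> (C \<rhd> Y)"
proof -
  let ?X = "X \<^bold>\<and> \<^bold>\<box> \<^bold>\<not> X" and ?Y = "Y \<^bold>\<and> \<^bold>\<box> \<^bold>\<not> Y"
  have "ILm \<Sigma> \<turnstile> (C \<rhd> ?X) \<^bold>\<rightarrow> (C \<rhd> ?Y)"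
    by (rule R1, rule ILm_taut1[OF Loeb_equiv[OF XY]]) (unfold tval.simps, blast)
  moreover have "ILm \<Sigma> \<turnstile> (C \<rhd> ?Y) \<^bold>\<rightarrow> (C \<rhd> ?X)"
    by (rule R1, rule ILm_taut1[OF Loeb_equiv[OF XY]]) (unfold tval.simps, blast)
  ultimately have "ILm \<Sigma> \<turnstile> (C \<rhd> ?X) \<^bold>\<leftrightarrow> (C \<rhd> ?Y)"
    by (rule ILm_taut2) (unfold tval.simps, blast)
  with Rhd_Loeb_right[OF J, of C X] Rhd_Loeb_right[OF J, of C Y] show ?thesis
    by (rule ILm_taut3) (unfold tval.simps, blast)
qed

theorem theorem5p2:
  fixes A B F :: fm and p :: nat
  assumes "F = subst A p \<^bold>\<top> \<rhd> subst B p (\<^bold>\<box> \<^bold>\<not> (subst A p \<^bold>\<top>))"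
  shows "ILm (J2plus \<union> J5) \<turnstile> F \<^bold>\<leftrightarrow> (subst A p F \<rhd> subst B p F)"
proof -
  let ?S = "J2plus \<union> J5"
  let ?T = "subst A p \<^bold>\<top>"
  let ?G = "\<^bold>\<box> \<^bold>\<not> ?T"
  let ?B = "subst B p ?G"
  have J: "J2plus \<subseteq> ?S" "J5 \<subseteq> ?S" by auto
  have GF: "ILm ?S \<turnstile> ?G \<^bold>\<rightarrow> F"
    unfolding assms by (rule Rhd_of_Box_Neg)
  then have "ILm ?S \<turnstile> \<^bold>\<box> \<^bold>\<not> ?T \<^bold>\<rightarrow> (\<^bold>\<top> \<^bold>\<leftrightarrow> F)"
    by (rule ILm_taut1) (unfold tval.simps, blast)
  \<comment> \<open>The congruence is applied to A with K = ~\<open>?T\<close>. As \<open>?T\<close>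
    is itself A(Top), the box in its premise is exactly the []~X that the exchange requires for X =
    A(Top), Y = A(F).\<close>
  from Rhd_left_exchange[OF J subst_cong_Box[OF J(1) this]]
  have left: "ILm ?S \<turnstile> (?T \<rhd> subst B p F) \<^bold>\<leftrightarrow> (subst A p F \<rhd> subst B p F)" .
  have "ILm ?S \<turnstile> \<^bold>\<box> \<^bold>\<not> ?B \<^bold>\<rightarrow> F \<^bold>\<rightarrow> ?G"
    \<comment> \<open>~\<open>?B\<close> is by definition \<open>?B\<close> -> Bot, so its box moves
      \<open>?T\<close> |> \<open>?B\<close> to \<open>?T\<close> |> Bot.\<close>
    unfolding assms using Box_imp_Rhd_mono[OF J(1), of ?B "\<^bold>\<bottom>" ?T] Rhd_Bot_imp_Box_Neg[of ?S ?T]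
    by (rule ILm_taut2) (unfold tval.simps, blast)
  with GF have "ILm ?S \<turnstile> \<^bold>\<box> \<^bold>\<not> ?B \<^bold>\<rightarrow> (?G \<^bold>\<leftrightarrow> F)"
    by (rule ILm_taut2) (unfold tval.simps, blast)
  \<comment> \<open>Here K = ~\<open>?B\<close>, X = \<open>?B\<close> = B(G) and Y = B(F). The left
    side of the resulting equivalence, \<open>?T\<close> |> \<open>?B\<close>, is F itself.\<close>
  from Rhd_right_exchange[OF J subst_cong_Box[OF J(1) this]]
  have "ILm ?S \<turnstile> F \<^bold>\<leftrightarrow> (?T \<rhd> subst B p F)"
    by (simp only: assms)
  then show ?thesis
    using left by (rule ILm_taut2) (unfold tval.simps, blast)
qed

end
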